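(* For all integers $k\ge 0$ and $n\ge k+2$, $\mathrm{av}_n^k(1324,1342)$ equals the number of overpartitions of $k$. In particular, $$C_{1324,1342}(x)=\prod_{k\ge 1}\frac{1+x^k}{1-x^k}.$$
   Context: $\mathrm{av}_n^k(B)$ is the number of permutations in $S_n$ with exactly $k$ inversions (pairs $i<j$ with $\pi_i>\pi_j$) that avoid every pattern in $B$; a permutation avoids a pattern $q$ if it has no subsequence order-isomorphic to $q$. If for every $k\ge0$ there are constants $m_k,c_k(B)$ with $\mathrm{av}_n^k(B)=c_k(B)$ for all $n\ge m_k$, then $(c_k(B))_{k\ge0}$ is the limit sequence of $B$ and $C_B(x)=\sum_{k\ge 0}c_k(B)x^k$ is its limit generating function. An overpartition of $k$ is a partition of $k$ in which the first occurrence of each part size may either be overlined or not. *)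

theory Defs
  imports
    "HOL-Analysis.Infinite_Products"
    "HOL-Computational_Algebra.Formal_Power_Series"
    "HOL-Combinatorics.Multiset_Permutations"
    "HOL-Library.Sublist"
begin

text \<open>
  A permutation \<open>\<pi>\<close> in $S_n$ is given in one-line notation, as an element of
  \<^term>\<open>permutations_of_set {1..n}\<close>; patterns are lists as well. List positions are counted from 0.
\<close>

definition order_isomorphic :: "nat list \<Rightarrow> nat list \<Rightarrow> bool" where
  "order_isomorphic xs ys \<longleftrightarrow>
     length xs = length ys \<and>
     (\<forall>i<length xs. \<forall>j<length xs. xs ! i < xs ! j \<longleftrightarrow> ys ! i < ys ! j)"

text \<open>In \<^const>\<open>subseq\<close>, the chosen entries need not be adjacent.\<close>

definition avoids :: "nat list \<Rightarrow> nat list \<Rightarrow> bool" where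
  "avoids p q \<longleftrightarrow> \<not> (\<exists>s. subseq s p \<and> order_isomorphic s q)"

definition inversions :: "nat list \<Rightarrow> (nat \<times> nat) set" where
  "inversions p = {(i, j). i < j \<and> j < length p \<and> p ! i > p ! j}"

definition av :: "nat list set \<Rightarrow> nat \<Rightarrow> nat \<Rightarrow> nat" where
  "av B n k =
     card {p \<in> permutations_of_set {1..n}. card (inversions p) = k \<and> (\<forall>q\<in>B. avoids p q)}"

definition has_limit_sequence :: "nat list set \<Rightarrow> (nat \<Rightarrow> nat) \<Rightarrow> bool" where
  "has_limit_sequence B c \<longleftrightarrow> (\<forall>k. \<exists>m. \<forall>n\<ge>m. av B n k = c k)"

text \<open>
  There is at most one limit sequence. If there is none, the following two constants are
  unspecified.
\<close>

definition limit_sequence :: "nat list set \<Rightarrow> nat \<Rightarrow> nat" where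
  "limit_sequence B = (THE c. has_limit_sequence B c)"

definition limit_gf :: "nat list set \<Rightarrow> rat fps" where
  "limit_gf B = Abs_fps (\<lambda>k. of_nat (limit_sequence B k))"

text \<open>
  An overpartition is the weakly decreasing list of its parts, each paired with a flag saying
  whether it is overlined. The last condition allows only the first occurrence of a part size
  to be overlined.
\<close>

definition overpartitions :: "nat \<Rightarrow> (nat \<times> bool) list set" where
  "overpartitions k =
     {xs. sorted_wrt (\<ge>) (map fst xs) \<and> (\<forall>a\<in>set (map fst xs). a \<ge> 1) \<and>
          sum_list (map fst xs) = k \<and>
          (\<forall>i<length xs. snd (xs ! i) \<longrightarrow> fst (xs ! i) \<notin> set (map fst (take i xs)))}"

end

(* The Lehmer code c_i = #{j > i. p_j < p_i} sends permutations of length n bijectively onto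
   sequences with c_i + i < n, and inversions to the sum. If k + 2 <= n, a permutation with k
   inversions avoids 1324 and 1342 iff its code weakly decreases up to the first 0 and from there on
   every code is 0 or as large as possible (n - 1 - i): after a left-to-right minimum, larger entries
   must avoid 213 and 231, so each of them is an extremum of what follows. The first block is a
   partition, the nonzero entries of the second are distinct, and a pair of a partition and a
   partition into distinct parts has the same generating function as an overpartition. *)

theory Submission
  imports Defs
begin

section \<open>Lehmer codes\<close>

primrec lehmer :: "nat list \<Rightarrow> nat list" where
  "lehmer [] = []"
| "lehmer (x # xs) = card {y \<in> set xs. y < x} # lehmer xs"

lemma length_lehmer [simp]: "length (lehmer xs) = length xs"
  by (induction xs) auto

lemma lehmer_nth:
  "i < length xs \<Longrightarrow> lehmer xs ! i = card {y \<in> set (drop (Suc i) xs). y < xs ! i}"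
proof (induction xs arbitrary: i)
  case (Cons x xs)
  then show ?case by (cases i) auto
qed simp

lemma inversions_Cons:
  "inversions (x # xs) =
     (\<lambda>j. (0, Suc j)) ` {j. j < length xs \<and> xs ! j < x} \<union> map_prod Suc Suc ` inversions xs"
  (is "?L = ?A \<union> ?B")
proof (intro set_eqI iffI)
  fix p assume "p \<in> ?L"
  then obtain i j where p: "p = (i, j)" "i < j" "j < length (x # xs)"
      "(x # xs) ! j < (x # xs) ! i"
    by (auto simp: inversions_def)
  then obtain j' where j: "j = Suc j'" by (cases j) auto
  show "p \<in> ?A \<union> ?B"
  proof (cases i)
    case 0
    then show ?thesis using p j by auto
  next
    case (Suc i')
    then have "(i', j') \<in> inversions xs" using p j by (auto simp: inversions_def)
    then have "map_prod Suc Suc (i', j') \<in> ?B" by (rule imageI)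
    then show ?thesis using p j Suc by auto
  qed
qed (auto simp: inversions_def)

lemma finite_inversions: "finite (inversions xs)"
  by (rule finite_subset[of _ "{..<length xs} \<times> {..<length xs}"]) (auto simp: inversions_def)

text \<open>Inversions are grouped by their left position. Code entries count smaller later values
  while inversions count positions; distinctness matches the two.\<close>

lemma card_inversions: "distinct xs \<Longrightarrow> card (inversions xs) = sum_list (lehmer xs)"
proof (induction xs)
  case Nil
  then show ?case by (simp add: inversions_def)
next
  case (Cons x xs)
  have "{y \<in> set xs. y < x} = (!) xs ` {j. j < length xs \<and> xs ! j < x}"
    by (auto simp: in_set_conv_nth)
  moreover have "inj_on ((!) xs) {j. j < length xs \<and> xs ! j < x}"
    using Cons.prems by (auto simp: inj_on_def nth_eq_iff_index_eq)
  ultimately have "card {y \<in> set xs. y < x} = card {j. j < length xs \<and> xs ! j < x}"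
    by (simp add: card_image)
  moreover have "card (inversions (x # xs)) =
      card ((\<lambda>j. (0::nat, Suc j)) ` {j. j < length xs \<and> xs ! j < x}) +
      card (map_prod Suc Suc ` inversions xs)"
    unfolding inversions_Cons
    by (intro card_Un_disjoint) (auto simp: finite_inversions)
  moreover have "card ((\<lambda>j. (0::nat, Suc j)) ` {j. j < length xs \<and> xs ! j < x}) =
      card {j. j < length xs \<and> xs ! j < x}"
    by (rule card_image) (auto simp: inj_on_def)
  moreover have "card (map_prod Suc Suc ` inversions xs) = card (inversions xs)"
    by (rule card_image) (auto simp: inj_on_def)
  ultimately show ?case using Cons by simp
qed

text \<open>The bound says that an entry is at most the number of positions to its right; the
  additive form avoids truncated subtraction.\<close>

definition lehmer_codes :: "nat \<Rightarrow> nat list set" where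
  "lehmer_codes n = {c. length c = n \<and> (\<forall>i<n. c ! i + i < n)}"

lemma Cons_in_lehmer_codes:
  "x # c \<in> lehmer_codes (Suc n) \<longleftrightarrow> x \<le> n \<and> c \<in> lehmer_codes n"
  by (auto simp: lehmer_codes_def All_less_Suc2)

text \<open>The rank of an element is strictly increasing, hence injective, and stays below
  \<open>card A\<close> because an element is not below itself; equal cardinalities give
  surjectivity.\<close>

lemma bij_betw_card_below:
  assumes "finite (A :: nat set)"
  shows "bij_betw (\<lambda>x. card {y \<in> A. y < x}) A {..<card A}"
proof -
  let ?r = "\<lambda>x. card {y \<in> A. y < x}"
  have less: "?r x < ?r y" if "x \<in> A" "x < y" for x y
    using that assms by (intro psubset_card_mono) auto
  have inj: "inj_on ?r A"
    by (rule linorder_inj_onI') (use less in \<open>auto dest: less_imp_neq\<close>)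
  have "?r ` A \<subseteq> {..<card A}"
  proof (intro image_subsetI)
    fix x assume "x \<in> A"
    then show "?r x \<in> {..<card A}"
      using assms by (auto intro!: psubset_card_mono)
  qed
  then have "?r ` A = {..<card A}"
    by (intro card_subset_eq) (auto simp: card_image[OF inj])
  with inj show ?thesis by (simp add: bij_betw_def)
qed

text \<open>The first code is the rank of the first entry in \<open>A\<close>, which determines that
  entry; the rest is a permutation of what remains. The set is arbitrary because deleting an entry
  from an interval need not leave an interval.\<close>

lemma bij_betw_lehmer:
  assumes "finite A"
  shows "bij_betw lehmer (permutations_of_set A) (lehmer_codes (card A))"
  using assms
proof (induction "card A" arbitrary: A)
  case 0
  then show ?case by (auto simp: bij_betw_def lehmer_codes_def)
next
  case (Suc n)
  let ?r = "\<lambda>x. card {y \<in> A. y < x}"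
  have r: "bij_betw ?r A {..<Suc n}"
    using bij_betw_card_below[OF Suc.prems] Suc.hyps(2) by simp
  have IH: "bij_betw lehmer (permutations_of_set (A - {x})) (lehmer_codes n)" if "x \<in> A" for x
  proof -
    have "n = card (A - {x})"
      using Suc.hyps(2) that by simp
    then show ?thesis using Suc.hyps(1)[of "A - {x}"] Suc.prems by simp
  qed
  have A: "A \<noteq> {}" using Suc.hyps(2) by auto
  \<comment> \<open>The code counts only entries after \<open>x\<close>, but adding \<open>x\<close>
    itself to the count changes nothing, so it is the rank in all of \<open>A\<close>.\<close>
  have lehmer_Cons: "lehmer (x # xs) = ?r x # lehmer xs"
    if "x \<in> A" "xs \<in> permutations_of_set (A - {x})" for x xs
    using that by (auto dest!: permutations_of_setD(1) intro!: arg_cong[of _ _ card])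
  have P: "permutations_of_set A = (\<Union>x\<in>A. (#) x ` permutations_of_set (A - {x}))"
    using permutations_of_set_nonempty[OF A] .
  show ?case
    unfolding Suc.hyps(2)[symmetric] bij_betw_def
  proof (intro conjI inj_onI)
    fix p q assume p: "p \<in> permutations_of_set A" and q: "q \<in> permutations_of_set A"
      and eq: "lehmer p = lehmer q"
    obtain x xs where x: "p = x # xs" "x \<in> A" "xs \<in> permutations_of_set (A - {x})"
      using p P by auto
    obtain y ys where y: "q = y # ys" "y \<in> A" "ys \<in> permutations_of_set (A - {y})"
      using q P by auto
    have "?r x = ?r y" "lehmer xs = lehmer ys"
      using eq lehmer_Cons x y by auto
    moreover from this(1) have "x = y"
      using r x y by (auto simp: bij_betw_def dest: inj_onD)
    ultimately show "p = q"
      using IH[of x] x y by (auto simp: bij_betw_def dest: inj_onD)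
  next
    show "lehmer ` permutations_of_set A = lehmer_codes (Suc n)"
    proof (intro equalityI subsetI)
      fix c assume "c \<in> lehmer ` permutations_of_set A"
      then obtain x xs where x: "c = lehmer (x # xs)" "x \<in> A" "xs \<in> permutations_of_set (A - {x})"
        using P by auto
      then have "?r x \<in> {..<Suc n}" "lehmer xs \<in> lehmer_codes n"
        using r IH by (auto simp: bij_betw_def)
      then show "c \<in> lehmer_codes (Suc n)"
        using x lehmer_Cons by (auto simp: Cons_in_lehmer_codes)
    next
      fix c assume c: "c \<in> lehmer_codes (Suc n)"
      then obtain a d where ad: "c = a # d"
        by (cases c) (auto simp: lehmer_codes_def)
      then have "a < Suc n" "d \<in> lehmer_codes n"
        using c by (auto simp: Cons_in_lehmer_codes)
      from this(1) have "a \<in> ?r ` A"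
        unfolding bij_betw_imp_surj_on[OF r] by (rule lessThan_iff[THEN iffD2])
      then obtain x where x: "?r x = a" "x \<in> A" by (rule imageE) simp
      have "d \<in> lehmer ` permutations_of_set (A - {x})"
        using \<open>d \<in> _\<close> unfolding bij_betw_imp_surj_on[OF IH[OF x(2)]] .
      then obtain xs where "lehmer xs = d" "xs \<in> permutations_of_set (A - {x})"
        by (rule imageE) simp
      then show "c \<in> lehmer ` permutations_of_set A"
        using x lehmer_Cons P ad by (intro image_eqI[of _ _ "x # xs"]) auto
    qed
  qed
qed

section \<open>Avoiding 1324 and 1342\<close>

lemma subseq_Cons_iff_nth:
  "subseq (x # s) p \<longleftrightarrow> (\<exists>i<length p. p ! i = x \<and> subseq s (drop (Suc i) p))"
proof (induction p)
  case (Cons y p)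
  show ?case
  proof (cases "x = y")
    case True
    then have "subseq (x # s) (y # p) \<longleftrightarrow> subseq s p" by simp
    moreover have "subseq s p" if "subseq s (drop i p)" for i
      using that suffix_drop[of i p] by (meson subseq_order.trans suffix_imp_subseq)
    ultimately show ?thesis using True by (auto intro!: exI[of _ 0])
  next
    case False
    then show ?thesis using Cons by (auto simp: Ex_less_Suc2)
  qed
qed simp

lemma order_isomorphic_1324:
  "order_isomorphic s [1,3,2,4] \<longleftrightarrow>
     (\<exists>a b c d. s = [a,b,c,d] \<and> a < c \<and> c < b \<and> b < d)"
proof -
  have "order_isomorphic [a,b,c,d] [1,3,2,4] \<longleftrightarrow> a < c \<and> c < b \<and> b < d" for a b c d
    unfolding order_isomorphic_def by (simp add: All_less_Suc2) auto
  moreover have "\<exists>a b c d. s = [a,b,c,d]" if "order_isomorphic s [1,3,2,4]"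
    using that by (auto simp: order_isomorphic_def length_Suc_conv)
  ultimately show ?thesis by blast
qed

lemma order_isomorphic_1342:
  "order_isomorphic s [1,3,4,2] \<longleftrightarrow>
     (\<exists>a b c d. s = [a,b,c,d] \<and> a < d \<and> d < b \<and> b < c)"
proof -
  have "order_isomorphic [a,b,c,d] [1,3,4,2] \<longleftrightarrow> a < d \<and> d < b \<and> b < c" for a b c d
    unfolding order_isomorphic_def by (simp add: All_less_Suc2) auto
  moreover have "\<exists>a b c d. s = [a,b,c,d]" if "order_isomorphic s [1,3,4,2]"
    using that by (auto simp: order_isomorphic_def length_Suc_conv)
  ultimately show ?thesis by blast
qed

text \<open>This forgets the order of two entries, and 1324 and 1342 differ only in the order of
  their last two letters.\<close>

lemma subseq_pair:
  "distinct p \<Longrightarrow> {u, v} \<subseteq> set p \<and> u \<noteq> v \<longleftrightarrow> subseq [u, v] p \<or> subseq [v, u] p"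
  by (induction p) (auto simp: subseq_singleton_left)

text \<open>An occurrence of either pattern consists of a 1 and a 3 at positions
  \<open>a < b\<close> and a 2 and a 4 anywhere after \<open>b\<close>. With both patterns
  forbidden, the order of \<open>y\<close> and \<open>z\<close> is irrelevant.\<close>

lemma avoids_1324_1342_iff:
  assumes "distinct p"
  shows "avoids p [1,3,2,4] \<and> avoids p [1,3,4,2] \<longleftrightarrow>
    \<not> (\<exists>a b y z. a < b \<and> b < length p \<and> y \<in> set (drop (Suc b) p) \<and> z \<in> set (drop (Suc b) p) \<and>
         p ! a < y \<and> y < p ! b \<and> p ! b < z)"
    (is "_ \<longleftrightarrow> \<not> ?P")
proof -
  \<comment> \<open>The first two letters are located by position, the last two remain a subsequence
    of the suffix, to which \<open>pair\<close> then applies.\<close>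
  have sub: "subseq [u, v, w, x] p \<longleftrightarrow>
      (\<exists>a b. a < b \<and> b < length p \<and> p ! a = u \<and> p ! b = v \<and> subseq [w, x] (drop (Suc b) p))"
    (is "?l \<longleftrightarrow> ?r") for u v w x
  proof
    assume ?l
    then obtain a i where "a < length p" "p ! a = u" "i < length p - Suc a"
        "p ! (Suc a + i) = v" "subseq [w, x] (drop (Suc i) (drop (Suc a) p))"
      by (auto simp: subseq_Cons_iff_nth[of u] subseq_Cons_iff_nth[of v])
    then show ?r
      by (intro exI[of _ a] exI[of _ "Suc a + i"]) (auto simp: ac_simps)
  next
    assume ?r
    then obtain a b where *: "a < b" "b < length p" "p ! a = u" "p ! b = v"
        "subseq [w, x] (drop (Suc b) p)" by blast
    have "subseq [v, w, x] (drop (Suc a) p)"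
      unfolding subseq_Cons_iff_nth[of v]
      using * by (intro exI[of _ "b - Suc a"]) (auto simp: Suc_diff_Suc)
    then show ?l
      unfolding subseq_Cons_iff_nth[of u]
      using * by (intro exI[of _ a]) simp
  qed
  have pair: "{y, z} \<subseteq> set (drop i p) \<and> y \<noteq> z \<longleftrightarrow>
      subseq [y, z] (drop i p) \<or> subseq [z, y] (drop i p)" for y z i
    using assms by (intro subseq_pair) auto
  have "\<not> (avoids p [1,3,2,4] \<and> avoids p [1,3,4,2]) \<longleftrightarrow>
      (\<exists>a b c d. (subseq [a,b,c,d] p \<or> subseq [a,b,d,c] p) \<and> a < c \<and> c < b \<and> b < d)"
    unfolding avoids_def order_isomorphic_1324 order_isomorphic_1342 by blast
  also have "\<dots> \<longleftrightarrow> (\<exists>a b y z. a < b \<and> b < length p \<and>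
      ({y, z} \<subseteq> set (drop (Suc b) p) \<and> y \<noteq> z) \<and> p ! a < y \<and> y < p ! b \<and> p ! b < z)"
    unfolding sub pair by blast
  also have "\<dots> \<longleftrightarrow> ?P" by (intro iff_exI) auto
  finally show ?thesis by blast
qed

text \<open>Here \<open>m\<close> is the position of the first 0, or the length if there is none.
  The value \<open>length c - Suc i\<close> is the largest code possible at position
  \<open>i\<close>; at the last position it coincides with 0.\<close>

definition descending_then_extremal :: "nat list \<Rightarrow> bool" where
  "descending_then_extremal c \<longleftrightarrow>
     (let m = length (takeWhile ((<) 0) c) in
        sorted_wrt (\<ge>) (take m c) \<and>
        (\<forall>i<length c. m \<le> i \<longrightarrow> c ! i = 0 \<or> c ! i = length c - Suc i))"

section \<open>Suffix minima, suffix maxima and ascents read off the code\<close>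

lemma lehmer_eq_0_iff:
  "i < length p \<Longrightarrow> lehmer p ! i = 0 \<longleftrightarrow> (\<forall>y\<in>set (drop (Suc i) p). p ! i \<le> y)"
  by (auto simp: lehmer_nth card_eq_0_iff leI)

lemma lehmer_eq_max_iff:
  assumes "distinct p" "i < length p"
  shows "lehmer p ! i = length p - Suc i \<longleftrightarrow> (\<forall>y\<in>set (drop (Suc i) p). y < p ! i)"
proof -
  let ?E = "set (drop (Suc i) p)"
  have E: "card ?E = length p - Suc i"
    using assms(1) by (simp add: distinct_card)
  have "card {y \<in> ?E. y < p ! i} = card ?E \<longleftrightarrow> {y \<in> ?E. y < p ! i} = ?E"
    by (metis (no_types, lifting) List.finite_set card_subset_eq mem_Collect_eq subsetI)
  then show ?thesis using assms E by (auto simp: lehmer_nth)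
qed

text \<open>If such a \<open>y\<close> exists, all entries counted at \<open>i\<close> are counted
  at \<open>Suc i\<close>, and \<open>y\<close> is counted only there. If none exists, all entries
  counted at \<open>Suc i\<close> lie below \<open>p ! i\<close>, equality being excluded by
  distinctness, so the code does not rise.\<close>

lemma lehmer_ascent_iff:
  assumes "distinct p" "Suc i < length p"
  shows "lehmer p ! i < lehmer p ! Suc i \<longleftrightarrow>
    (\<exists>y\<in>set (drop (Suc (Suc i)) p). p ! i < y \<and> y < p ! Suc i)" (is "?l \<longleftrightarrow> ?r")
proof -
  let ?E = "set (drop (Suc (Suc i)) p)"
  have E: "set (drop (Suc i) p) = insert (p ! Suc i) ?E"
    using assms(2) by (simp flip: Cons_nth_drop_Suc)
  have i: "lehmer p ! i = card {y \<in> insert (p ! Suc i) ?E. y < p ! i}"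
    using assms(2) E by (simp add: lehmer_nth)
  have Si: "lehmer p ! Suc i = card {y \<in> ?E. y < p ! Suc i}"
    using assms(2) by (simp add: lehmer_nth)
  show ?thesis
  proof
    assume ?r
    then obtain y where "y \<in> ?E" "p ! i < y" "y < p ! Suc i" by blast
    then have "{y \<in> insert (p ! Suc i) ?E. y < p ! i} \<subseteq> {y \<in> ?E. y < p ! Suc i}"
      "y \<in> {y \<in> ?E. y < p ! Suc i}" "y \<notin> {y \<in> insert (p ! Suc i) ?E. y < p ! i}"
      by (auto dest: less_trans)
    then have "{y \<in> insert (p ! Suc i) ?E. y < p ! i} \<subset> {y \<in> ?E. y < p ! Suc i}"
      by blast
    then show ?l
      unfolding i Si by (rule psubset_card_mono[rotated]) simp
  next
    assume ?l
    show ?r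
    proof (rule ccontr)
      assume "\<not> ?r"
      moreover have "p ! i \<notin> ?E"
        using assms by (auto simp: in_set_conv_nth nth_eq_iff_index_eq)
      ultimately have "{y \<in> ?E. y < p ! Suc i} \<subseteq> {y \<in> insert (p ! Suc i) ?E. y < p ! i}"
        by (auto simp: not_less) (metis le_neq_implies_less leD)
      then have "lehmer p ! Suc i \<le> lehmer p ! i"
        unfolding i Si by (intro card_mono) auto
      with \<open>?l\<close> show False by simp
    qed
  qed
qed

text \<open>A discrete intermediate value theorem. It moves the 1 and 3 of a pattern from distant
  positions to adjacent ones, where \<open>lehmer_ascent_iff\<close> applies.\<close>

lemma nat_crossing:
  fixes f :: "nat \<Rightarrow> nat"
  assumes "a < b" "f a < y" "y \<le> f b"
  shows "\<exists>i. a \<le> i \<and> i < b \<and> f i < y \<and> y \<le> f (Suc i)"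
  using assms
proof (induction b)
  case (Suc b)
  show ?case
  proof (cases "y \<le> f b")
    case True
    moreover have "a < b" using True Suc.prems by (metis less_SucE not_le)
    ultimately show ?thesis using Suc by (metis less_SucI)
  next
    case False
    then show ?thesis using Suc.prems by (intro exI[of _ b]) auto
  qed
qed simp

text \<open>
  If an entry of the initial run of nonzero codes is smaller than the next one, they form a 132
  together with a later entry. Avoidance then makes the larger of the two a maximum of its suffix,
  and its code together with the preceding nonzero ones already sums to \<open>length p - 1\<close>.
\<close>

lemma avoids_1324_1342_iff_lehmer:
  assumes p: "distinct p" and sum: "sum_list (lehmer p) + 2 \<le> length p"
  shows "avoids p [1,3,2,4] \<and> avoids p [1,3,4,2] \<longleftrightarrow> descending_then_extremal (lehmer p)"
proof -
  define c where "c = lehmer p"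
  define m where "m = length (takeWhile ((<) 0) c)"
  have len: "length c = length p" by (simp add: c_def)
  have nz: "c ! i \<noteq> 0" if "i < m" for i
    using that nth_mem[of i "takeWhile ((<) 0) c"] takeWhile_nth[of i "(<) 0" c]
    by (auto simp: m_def dest: set_takeWhileD)
  \<comment> \<open>Nothing follows the last entry, so its code is 0 and the first zero position
    \<open>m\<close> lies inside the list.\<close>
  have "c ! (length p - 1) = 0"
    using sum by (simp add: c_def lehmer_nth)
  then have m_less: "m < length p"
    using nz[of "length p - 1"] sum by linarith
  have zero: "c ! m = 0"
    using nth_length_takeWhile[of "(<) 0" c] m_less len by (simp add: m_def)
  \<comment> \<open>Failure is localized: either two adjacent codes ascend before \<open>m\<close>,
    or a single code from \<open>m\<close> on is not extremal. The two alternatives correspond to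
    the cases \<open>b < m\<close> and \<open>m \<le> b\<close> of an occurrence.\<close>
  have bad: "\<not> descending_then_extremal c \<longleftrightarrow>
      (\<exists>i. Suc i < m \<and> c ! i < c ! Suc i) \<or>
      (\<exists>i. m \<le> i \<and> i < length p \<and> c ! i \<noteq> 0 \<and> c ! i \<noteq> length p - Suc i)"
  proof -
    have "sorted_wrt (\<ge>) (take m c) \<longleftrightarrow> (\<forall>i. Suc i < m \<longrightarrow> c ! Suc i \<le> c ! i)"
      using m_less len by (subst sorted_wrt_iff_nth_Suc_transp) (auto intro: transpI)
    then show ?thesis
      unfolding descending_then_extremal_def Let_def m_def[symmetric] len by (auto simp: not_le)
  qed
  have "(\<exists>a b y z. a < b \<and> b < length p \<and> y \<in> set (drop (Suc b) p) \<and> z \<in> set (drop (Suc b) p) \<and>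
      p ! a < y \<and> y < p ! b \<and> p ! b < z) \<longleftrightarrow> \<not> descending_then_extremal c" (is "?P \<longleftrightarrow> _")
  proof
    assume ?P
    then obtain a b y z where *: "a < b" "b < length p" "y \<in> set (drop (Suc b) p)"
      "z \<in> set (drop (Suc b) p)" "p ! a < y" "y < p ! b" "p ! b < z" by blast
    show "\<not> descending_then_extremal c"
    proof (cases "b < m")
      case False
      \<comment> \<open>The smaller later entry \<open>y\<close> rules out code 0, the larger later
        entry \<open>z\<close> rules out the maximal code.\<close>
      have "c ! b \<noteq> 0"
        unfolding c_def lehmer_eq_0_iff[OF *(2)] using *(3,6) leD by blast
      moreover have "c ! b \<noteq> length p - Suc b"
        unfolding c_def lehmer_eq_max_iff[OF p *(2)] using *(4,7) less_asym by blast
      ultimately show ?thesis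
        unfolding bad using False *(2) by (metis not_less)
    next
      case True
      \<comment> \<open>The values cross \<open>y\<close> somewhere between \<open>a\<close> and
        \<open>b\<close>. Since \<open>y\<close> comes after \<open>b\<close>, it stands behind both
        adjacent positions and forces an ascent of the code within the initial run.\<close>
      obtain i where i: "a \<le> i" "i < b" "p ! i < y" "y \<le> p ! Suc i"
        using nat_crossing[of a b "(!) p" y] * by auto
      have "y \<in> set (drop (Suc (Suc i)) p)"
        using *(3) i(2) set_drop_subset_set_drop[of "Suc (Suc i)" "Suc b" p] by auto
      moreover have "y \<noteq> p ! Suc i"
        using *(2,3) i(2) p by (auto simp: in_set_conv_nth nth_eq_iff_index_eq)
      ultimately have "\<exists>y\<in>set (drop (Suc (Suc i)) p). p ! i < y \<and> y < p ! Suc i"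
        using i(3,4) le_neq_implies_less by blast
      moreover have "Suc i < length p" using i(2) *(2) by simp
      ultimately have "c ! i < c ! Suc i"
        unfolding c_def using lehmer_ascent_iff[OF p, of i] by blast
      moreover have "Suc i < m" using True i(2) by simp
      ultimately show ?thesis unfolding bad by blast
    qed
  next
    assume "\<not> descending_then_extremal c"
    then consider (ascent) i where "Suc i < m" "c ! i < c ! Suc i"
      | (middle) i where "m \<le> i" "i < length p" "c ! i \<noteq> 0" "c ! i \<noteq> length p - Suc i"
      unfolding bad by blast
    then show ?P
    proof cases
      case ascent
      then obtain y where y: "y \<in> set (drop (Suc (Suc i)) p)" "p ! i < y" "y < p ! Suc i"
        using lehmer_ascent_iff[OF p, of i] m_less by (auto simp: c_def)
      have "c ! Suc i \<noteq> length p - Suc (Suc i)"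
      proof
        assume max: "c ! Suc i = length p - Suc (Suc i)"
        have "(\<Sum>j<Suc i. 1) \<le> (\<Sum>j<Suc i. c ! j)"
          using nz ascent by (intro sum_mono) (auto simp: Suc_le_eq)
        then have "Suc i + (length p - Suc (Suc i)) \<le> (\<Sum>j<Suc (Suc i). c ! j)"
          using max by simp
        also have "\<dots> \<le> (\<Sum>j<length c. c ! j)"
          using ascent m_less len by (intro sum_mono2) auto
        also have "\<dots> = sum_list c"
          by (simp add: sum_list_sum_nth atLeast0LessThan)
        finally show False using assms ascent m_less by (simp add: c_def)
      qed
      then obtain z where "z \<in> set (drop (Suc (Suc i)) p)" "p ! Suc i \<le> z"
        using lehmer_eq_max_iff[OF p, of "Suc i"] ascent m_less by (auto simp: c_def not_less)
      moreover have "p ! Suc i \<notin> set (drop (Suc (Suc i)) p)"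
        using ascent m_less p by (auto simp: in_set_conv_nth nth_eq_iff_index_eq)
      ultimately have "p ! Suc i < z" by (metis le_neq_implies_less)
      then show ?P
        using y \<open>z \<in> _\<close> ascent m_less
        by (intro exI[of _ i] exI[of _ "Suc i"] exI[of _ y] exI[of _ z]) simp
    next
      case middle
      \<comment> \<open>The entry at \<open>m\<close> has code 0, hence is smaller than everything
        after it and serves as the 1 of the pattern. The entry at \<open>i\<close> is the 3; its
        code being neither 0 nor maximal supplies the 2 and the 4.\<close>
      with zero have "m < i" by (metis le_neq_implies_less)
      obtain y z where yz: "y \<in> set (drop (Suc i) p)" "y < p ! i"
          "z \<in> set (drop (Suc i) p)" "p ! i \<le> z"
        using middle p by (auto simp: c_def lehmer_eq_0_iff lehmer_eq_max_iff not_le not_less)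
      have "p ! i \<notin> set (drop (Suc i) p)" "p ! m \<notin> set (drop (Suc i) p)"
        using middle m_less \<open>m < i\<close> p by (auto simp: in_set_conv_nth nth_eq_iff_index_eq)
      moreover have "y \<in> set (drop (Suc m) p)"
        using yz \<open>m < i\<close> set_drop_subset_set_drop[of "Suc m" "Suc i" p] by auto
      then have "p ! m \<le> y"
        using zero m_less by (simp add: c_def lehmer_eq_0_iff)
      ultimately have "p ! m < y" "p ! i < z"
        using yz(1,3,4) by (auto intro!: le_neq_implies_less)
      then show ?P
        using yz \<open>m < i\<close> middle(2)
        by (intro exI[of _ m] exI[of _ i] exI[of _ y] exI[of _ z]) simp
    qed
  qed
  then show ?thesis
    using avoids_1324_1342_iff[OF p] by (simp add: c_def)
qed

section \<open>Encoding pairs of partitions\<close>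

text \<open>Each of the \<open>i\<close> earlier entries contributes at least 1. This yields the
  bound of \<open>lehmer_codes\<close> for the partition block.\<close>

lemma nth_add_index_le_sum_list:
  "\<lbrakk>\<forall>x\<in>set xs. 0 < x; i < length xs\<rbrakk> \<Longrightarrow> xs ! i + i \<le> sum_list (xs :: nat list)"
proof (induction xs arbitrary: i)
  case (Cons x xs)
  then show ?case by (cases i) force+
qed simp

lemma length_le_sum_list: "\<forall>x\<in>set xs. 0 < x \<Longrightarrow> length xs \<le> sum_list (xs :: nat list)"
  by (induction xs) auto

text \<open>Reflecting positions by \<open>n - Suc i\<close> turns the sum over positions into a sum
  over values; the assumption ensures that each element of \<open>M\<close> has its position in the
  block.\<close>

lemma sum_list_extremal:
  assumes "M \<subseteq> {..<n - l}"
  shows "sum_list (map (\<lambda>i. if n - Suc i \<in> M then n - Suc i else 0) [l..<n]) = \<Sum>M"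
proof -
  have "sum_list (map (\<lambda>i. if n - Suc i \<in> M then n - Suc i else 0) [l..<n]) =
      (\<Sum>i\<in>{l..<n}. if n - Suc i \<in> M then n - Suc i else 0)"
    by (simp add: interv_sum_list_conv_sum_set_nat)
  also have "\<dots> = (\<Sum>j\<in>{..<n - l}. if j \<in> M then j else 0)"
    by (rule sum.reindex_bij_witness[of _ "\<lambda>j. n - Suc j" "\<lambda>i. n - Suc i"]) auto
  also have "\<dots> = \<Sum>({..<n - l} \<inter> M)"
    by (simp add: sum.inter_restrict)
  also have "{..<n - l} \<inter> M = M" using assms by blast
  finally show ?thesis .
qed

text \<open>Bounding the parts permits induction on \<open>N\<close>; for total \<open>k\<close> the
  bound excludes nothing once \<open>N \<ge> k\<close>.\<close>

definition bounded_partitions :: "nat \<Rightarrow> nat list set" where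
  "bounded_partitions N = {xs. sorted_wrt (\<ge>) xs \<and> set xs \<subseteq> {1..N}}"

text \<open>A set \<open>M\<close> stands for the partition into distinct parts with set of parts \<open>M\<close>.\<close>

definition partition_pairs :: "nat \<Rightarrow> (nat list \<times> nat set) set" where
  "partition_pairs N = bounded_partitions N \<times> Pow {1..N}"

definition pair_weight :: "nat list \<times> nat set \<Rightarrow> nat" where
  "pair_weight = (\<lambda>(xs, M). sum_list xs + \<Sum>M)"

text \<open>A part \<open>j\<close> of \<open>M\<close> goes to position \<open>n - Suc j\<close>,
  the one position at which \<open>j\<close> is the maximal code. Hence distinct parts never compete
  for a place.\<close>

definition encode :: "nat \<Rightarrow> nat list \<times> nat set \<Rightarrow> nat list" where
  "encode n = (\<lambda>(xs, M).
     xs @ map (\<lambda>i. if n - Suc i \<in> M then n - Suc i else 0) [length xs..<n])"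

text \<open>As parts are positive, \<open>length xs + \<Sum>M + 2 \<le> n\<close>, so every element
  of \<open>M\<close> is smaller than the maximal code at position \<open>length xs\<close>. That
  position therefore holds 0, which separates the two blocks and lets \<open>takeWhile\<close>
  recover \<open>xs\<close>.\<close>

lemma encode_props:
  assumes "(xs, M) \<in> partition_pairs N" "pair_weight (xs, M) + 2 \<le> n"
  shows "M \<subseteq> {0<..<n - Suc (length xs)}" "length xs < n"
    "takeWhile ((<) 0) (encode n (xs, M)) = xs"
    "sum_list (encode n (xs, M)) = pair_weight (xs, M)"
proof -
  have pos: "\<forall>x\<in>set xs. 0 < x" and M: "M \<subseteq> {1..N}"
    using assms(1) by (auto simp: partition_pairs_def bounded_partitions_def)
  have fin: "finite M" using M finite_subset by blast
  have w: "length xs + \<Sum>M + 2 \<le> n"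
    using length_le_sum_list[OF pos] assms(2) by (simp add: pair_weight_def)
  then show less: "length xs < n" by simp
  show sub: "M \<subseteq> {0<..<n - Suc (length xs)}"
  proof
    fix x assume "x \<in> M"
    then have "x \<le> \<Sum>M" using fin member_le_sum[of x M "\<lambda>x. x"] by simp
    then show "x \<in> {0<..<n - Suc (length xs)}" using w M \<open>x \<in> M\<close> by auto
  qed
  then have "n - Suc (length xs) \<notin> M" by auto
  then show "takeWhile ((<) 0) (encode n (xs, M)) = xs"
    using pos less by (simp add: encode_def upt_conv_Cons)
  have "M \<subseteq> {..<n - length xs}" by (rule subset_trans[OF sub]) auto
  then show "sum_list (encode n (xs, M)) = pair_weight (xs, M)"
    by (simp add: encode_def pair_weight_def sum_list_extremal)
qed

text \<open>Decoding takes \<open>xs\<close> to be the nonzero initial run and \<open>M\<close> the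
  set of positive maximal codes behind it. Parts are at most the total \<open>k\<close>, so
  \<open>k \<le> N\<close> keeps the decoded pair within the bound.\<close>

lemma bij_betw_encode:
  assumes n: "k + 2 \<le> n" and N: "k \<le> N"
  shows "bij_betw (encode n) {P \<in> partition_pairs N. pair_weight P = k}
    {c \<in> lehmer_codes n. sum_list c = k \<and> descending_then_extremal c}"
    (is "bij_betw _ ?A ?B")
  unfolding bij_betw_def
proof (intro conjI inj_onI)
  fix P Q assume "P \<in> ?A" "Q \<in> ?A" and eq: "encode n P = encode n Q"
  moreover obtain xs M ys K where PQ: "P = (xs, M)" "Q = (ys, K)"
    by (meson surj_pair)
  ultimately have P: "(xs, M) \<in> partition_pairs N" "pair_weight (xs, M) + 2 \<le> n"
    and Q: "(ys, K) \<in> partition_pairs N" "pair_weight (ys, K) + 2 \<le> n"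
    using n by auto
  have xs: "xs = ys"
    using encode_props(3)[OF P] encode_props(3)[OF Q] eq PQ by simp
  have same: "(if n - Suc i \<in> M then n - Suc i else 0) = (if n - Suc i \<in> K then n - Suc i else 0)"
    if "length ys \<le> i" "i < n" for i
    using eq that by (auto simp: encode_def PQ xs)
  have "M = K"
  proof (rule set_eqI)
    fix x
    show "x \<in> M \<longleftrightarrow> x \<in> K"
    \<comment> \<open>Outside this range neither set has elements. Inside it, membership of
      \<open>x\<close> is visible at position \<open>n - Suc x\<close>, because \<open>x\<close> is
      positive and so differs from the default 0.\<close>
    proof (cases "x \<in> {0<..<n - Suc (length ys)}")
      case True
      then have "length ys \<le> n - Suc x" "n - Suc x < n" and x: "n - Suc (n - Suc x) = x" "0 < x"
        by auto
      then show ?thesis using same[of "n - Suc x"] unfolding x by (simp split: if_splits)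
    next
      case False
      then show ?thesis
        using encode_props(1)[OF P] encode_props(1)[OF Q] unfolding xs by blast
    qed
  qed
  then show "P = Q" using PQ xs by simp
next
  show "encode n ` ?A = ?B"
  proof (intro equalityI image_subsetI subsetI)
    fix P assume P': "P \<in> ?A"
    moreover obtain xs M where Peq: "P = (xs, M)" by (meson surj_pair)
    ultimately have P: "(xs, M) \<in> partition_pairs N" "pair_weight (xs, M) + 2 \<le> n"
      using n by auto
    note props = encode_props[OF P]
    have pos: "\<forall>x\<in>set xs. 0 < x" and sorted: "sorted_wrt (\<ge>) xs"
      using P by (auto simp: partition_pairs_def bounded_partitions_def)
    define c where "c = encode n (xs, M)"
    have len: "length c = n" using props(2) by (simp add: c_def encode_def)
    have low: "c ! i = xs ! i" if "i < length xs" for i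
      using that by (simp add: c_def encode_def nth_append)
    have high: "c ! i = (if n - Suc i \<in> M then n - Suc i else 0)" if "length xs \<le> i" "i < n" for i
      using that by (simp add: c_def encode_def nth_append)
    have "c ! i + i < n" if "i < n" for i
    proof (cases "i < length xs")
      case True
      then show ?thesis
        using nth_add_index_le_sum_list[OF pos, of i] low P(2) by (simp add: pair_weight_def)
    next
      case False
      then show ?thesis using high[of i] that by simp
    qed
    then have "c \<in> lehmer_codes n" by (simp add: lehmer_codes_def len)
    moreover have "take (length xs) c = xs" by (simp add: c_def encode_def)
    then have "descending_then_extremal c"
      using props(3) sorted high len by (simp add: descending_then_extremal_def c_def)
    moreover have "sum_list c = k" using props(4) P' Peq by (simp add: c_def)
    ultimately show "encode n P \<in> ?B" by (simp add: c_def Peq)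
  next
    fix c assume c: "c \<in> ?B"
    define xs where "xs = takeWhile ((<) 0) c"
    define m where "m = length xs"
    \<comment> \<open>\<open>x < n - m\<close> keeps the inspected position in the second block;
      \<open>0 < x\<close> discards the last position, where the maximal code is 0.\<close>
    define M where "M = {x. 0 < x \<and> x < n - m \<and> c ! (n - Suc x) = x}"
    have len: "length c = n" using c by (simp add: lehmer_codes_def)
    have take: "take m c = xs" by (simp add: m_def xs_def flip: takeWhile_eq_take)
    have dte: "sorted_wrt (\<ge>) xs" "\<And>i. m \<le> i \<Longrightarrow> i < n \<Longrightarrow> c ! i = 0 \<or> c ! i = n - Suc i"
      using c take by (auto simp: descending_then_extremal_def m_def xs_def len Let_def)
    have "m \<le> n" using length_takeWhile_le[of "(<) 0" c] by (simp add: m_def xs_def len)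
    have enc: "encode n (xs, M) = c"
    proof (rule nth_equalityI)
      fix i assume "i < length (encode n (xs, M))"
      then have i: "i < n" using \<open>m \<le> n\<close> by (simp add: encode_def m_def)
      show "encode n (xs, M) ! i = c ! i"
      proof (cases "i < m")
        case True
        then show ?thesis by (simp add: encode_def nth_append m_def xs_def takeWhile_nth)
      next
        case False
        then have "n - Suc i \<in> M \<longleftrightarrow> 0 < n - Suc i \<and> c ! i = n - Suc i"
          using i by (auto simp: M_def)
        then show ?thesis
          using False i dte(2)[of i] by (auto simp: encode_def nth_append m_def)
      qed
    qed (use len \<open>m \<le> n\<close> in \<open>simp add: encode_def m_def\<close>)
    have "M \<subseteq> {..<n - length xs}" by (auto simp: M_def m_def)
    then have "sum_list (encode n (xs, M)) = sum_list xs + \<Sum>M"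
      by (simp add: encode_def sum_list_extremal)
    then have k: "sum_list xs + \<Sum>M = k" using c enc by simp
    have "set xs \<subseteq> {1..N}"
    proof
      fix x assume x: "x \<in> set xs"
      then have "0 < x" by (auto simp: xs_def dest: set_takeWhileD)
      moreover have "x \<le> sum_list xs" using x by (simp add: member_le_sum_list)
      ultimately show "x \<in> {1..N}" using k N by simp
    qed
    moreover have "M \<subseteq> {1..N}"
    proof
      fix x assume x: "x \<in> M"
      have "finite M" by (simp add: M_def)
      with x have "x \<le> \<Sum>M" using member_le_sum[of x M "\<lambda>x. x"] by simp
      then show "x \<in> {1..N}" using k N x by (simp add: M_def)
    qed
    ultimately have "(xs, M) \<in> ?A"
      using k dte(1) by (simp add: partition_pairs_def bounded_partitions_def pair_weight_def)
    then have "encode n (xs, M) \<in> encode n ` ?A" by (rule imageI)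
    then show "c \<in> encode n ` ?A" unfolding enc .
  qed
qed

text \<open>Composes the two bijections: \<open>lehmer\<close> carries inversions to the sum and
  avoidance to the shape of the code, and \<open>encode\<close> identifies such codes with
  pairs.\<close>

lemma av_1324_1342_eq_card_pairs:
  assumes "k + 2 \<le> n" "k \<le> N"
  shows "av {[1,3,2,4], [1,3,4,2]} n k = card {P \<in> partition_pairs N. pair_weight P = k}"
proof -
  have bij: "bij_betw lehmer (permutations_of_set {1..n}) (lehmer_codes n)"
    using bij_betw_lehmer[of "{1..n}"] by simp
  let ?L = "{p \<in> permutations_of_set {1..n}. card (inversions p) = k \<and>
      (\<forall>q\<in>{[1,3,2,4], [1,3,4,2]}. avoids p q)}"
  let ?R = "{c \<in> lehmer_codes n. sum_list c = k \<and> descending_then_extremal c}"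
  have iff: "card (inversions p) = k \<and> (\<forall>q\<in>{[1,3,2,4], [1,3,4,2]}. avoids p q) \<longleftrightarrow>
      sum_list (lehmer p) = k \<and> descending_then_extremal (lehmer p)"
    if "p \<in> permutations_of_set {1..n}" for p
  proof -
    have "distinct p" "length p = n"
      using that permutations_of_setD(2) length_finite_permutations_of_set by fastforce+
    then show ?thesis
      using card_inversions avoids_1324_1342_iff_lehmer assms(1) by auto
  qed
  have "?L = {p \<in> permutations_of_set {1..n}.
      sum_list (lehmer p) = k \<and> descending_then_extremal (lehmer p)}"
    by (intro Collect_cong conj_cong refl iff)
  then have "lehmer ` ?L = {c \<in> lehmer ` permutations_of_set {1..n}.
      sum_list c = k \<and> descending_then_extremal c}"
    by auto
  then have "lehmer ` ?L = ?R"
    unfolding bij_betw_imp_surj_on[OF bij] .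
  moreover have "card (lehmer ` ?L) = card ?L"
    by (intro card_image inj_on_subset[OF bij_betw_imp_inj_on[OF bij]] Collect_restrict)
  ultimately have "av {[1,3,2,4], [1,3,4,2]} n k = card ?R"
    unfolding av_def by argo
  also have "\<dots> = card {P \<in> partition_pairs N. pair_weight P = k}"
    using bij_betw_same_card[OF bij_betw_encode[OF assms]] by simp
  finally show ?thesis .
qed

section \<open>Generating functions\<close>

unbundle no vec_syntax and fps_syntax

text \<open>Since \<open>card\<close> is 0 on infinite sets, the sum and product rules below ask for
  finitely many elements of each weight.\<close>

definition weight_gf :: "'a set \<Rightarrow> ('a \<Rightarrow> nat) \<Rightarrow> rat fps" where
  "weight_gf S w = Abs_fps (\<lambda>k. of_nat (card {s \<in> S. w s = k}))"

lemma weight_gf_nth: "weight_gf S w $ k = of_nat (card {s \<in> S. w s = k})"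
  by (simp add: weight_gf_def)

lemma weight_gf_singleton: "w x = 0 \<Longrightarrow> weight_gf {x} w = 1"
proof (rule fps_ext)
  fix k
  assume "w x = 0"
  then have "{s \<in> {x}. w s = k} = (if k = 0 then {x} else {})" by auto
  then show "weight_gf {x} w $ k = 1 $ k" by (simp add: weight_gf_nth)
qed

lemma weight_gf_Un:
  assumes "S \<inter> T = {}" "\<And>k. finite {s \<in> S. w s = k}" "\<And>k. finite {s \<in> T. w s = k}"
  shows "weight_gf (S \<union> T) w = weight_gf S w + weight_gf T w"
proof (rule fps_ext)
  fix k
  have "{s \<in> S \<union> T. w s = k} = {s \<in> S. w s = k} \<union> {s \<in> T. w s = k}" by blast
  then have "card {s \<in> S \<union> T. w s = k} = card {s \<in> S. w s = k} + card {s \<in> T. w s = k}"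
    using assms by (simp add: card_Un_disjoint disjoint_iff)
  then show "weight_gf (S \<union> T) w $ k = (weight_gf S w + weight_gf T w) $ k"
    by (simp add: weight_gf_nth)
qed

lemma weight_gf_image:
  assumes "inj_on f S" "\<And>s. s \<in> S \<Longrightarrow> v (f s) = a + w s"
  shows "weight_gf (f ` S) v = fps_X ^ a * weight_gf S w"
proof (rule fps_ext)
  fix k
  have "{t \<in> f ` S. v t = k} = f ` {s \<in> S. a + w s = k}" using assms(2) by auto
  moreover have "inj_on f {s \<in> S. a + w s = k}" using assms(1) by (rule inj_on_subset) blast
  ultimately have "card {t \<in> f ` S. v t = k} = card {s \<in> S. a + w s = k}"
    by (simp add: card_image)
  moreover have "{s \<in> S. a + w s = k} = (if k < a then {} else {s \<in> S. w s = k - a})"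
    by auto
  ultimately show "weight_gf (f ` S) v $ k = (fps_X ^ a * weight_gf S w) $ k"
    by (simp add: weight_gf_nth fps_X_power_mult_nth)
qed

text \<open>Sorting the pairs of total weight \<open>k\<close> by the weight of the first component
  produces the Cauchy product.\<close>

lemma weight_gf_Times:
  assumes "\<And>k. finite {s \<in> S. w s = k}" "\<And>k. finite {t \<in> T. v t = k}"
  shows "weight_gf (S \<times> T) (\<lambda>(s, t). w s + v t) = weight_gf S w * weight_gf T v"
proof (rule fps_ext)
  fix k
  let ?F = "\<lambda>i. {s \<in> S. w s = i} \<times> {t \<in> T. v t = k - i}"
  have "{p \<in> S \<times> T. (\<lambda>(s, t). w s + v t) p = k} = (\<Union>i\<in>{0..k}. ?F i)" by auto
  moreover have "card (\<Union>i\<in>{0..k}. ?F i) = (\<Sum>i=0..k. card (?F i))"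
    by (rule card_UN_disjoint) (use assms in auto)
  ultimately show "weight_gf (S \<times> T) (\<lambda>(s, t). w s + v t) $ k = (weight_gf S w * weight_gf T v) $ k"
    by (simp add: weight_gf_nth fps_mult_nth card_cartesian_product)
qed

section \<open>Partitions and sets of distinct parts, with bounded part size\<close>

lemma finite_bounded_partitions: "finite {xs \<in> bounded_partitions N. sum_list xs = k}"
proof (rule finite_subset)
  show "{xs \<in> bounded_partitions N. sum_list xs = k} \<subseteq> {xs. set xs \<subseteq> {1..N} \<and> length xs \<le> k}"
  proof clarify
    fix xs assume xs: "xs \<in> bounded_partitions N"
    then have "\<forall>x\<in>set xs. 0 < x" by (auto simp: bounded_partitions_def)
    then show "set xs \<subseteq> {1..N} \<and> length xs \<le> sum_list xs"
      using xs by (simp add: bounded_partitions_def length_le_sum_list)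
  qed
qed (simp add: finite_lists_length_le)

text \<open>The largest possible part is either absent or stands first. Deleting one copy may leave
  further copies, so the same set recurs on the right, which encodes a geometric series.\<close>

lemma bounded_partitions_Suc:
  "bounded_partitions (Suc N) = bounded_partitions N \<union> (#) (Suc N) ` bounded_partitions (Suc N)"
proof (intro set_eqI iffI)
  fix xs assume xs: "xs \<in> bounded_partitions (Suc N)"
  show "xs \<in> bounded_partitions N \<union> (#) (Suc N) ` bounded_partitions (Suc N)"
  proof (cases "\<exists>ys. xs = Suc N # ys")
    case True
    then show ?thesis using xs by (auto simp: bounded_partitions_def)
  next
    case False
    then show ?thesis using xs by (cases xs) (fastforce simp: bounded_partitions_def)+
  qed
qed (fastforce simp: bounded_partitions_def)

text \<open>The self-referential decomposition, solved for the series with smaller bound. The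
  product form avoids division, so the factor can be cancelled later.\<close>

lemma weight_gf_bounded_partitions_Suc:
  "weight_gf (bounded_partitions (Suc N)) sum_list * (1 - fps_X ^ Suc N) =
   weight_gf (bounded_partitions N) sum_list"
proof -
  let ?S = "(#) (Suc N) ` bounded_partitions (Suc N)"
  have "finite {xs \<in> ?S. sum_list xs = k}" for k
    by (rule finite_subset[OF _ finite_bounded_partitions[of "Suc N" k]])
      (use bounded_partitions_Suc in blast)
  moreover have "bounded_partitions N \<inter> ?S = {}" by (auto simp: bounded_partitions_def)
  ultimately have "weight_gf (bounded_partitions (Suc N)) sum_list =
      weight_gf (bounded_partitions N) sum_list + weight_gf ?S sum_list"
    by (subst bounded_partitions_Suc, intro weight_gf_Un) (auto simp: finite_bounded_partitions)
  also have "weight_gf ?S sum_list =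
      fps_X ^ Suc N * weight_gf (bounded_partitions (Suc N)) sum_list"
    by (rule weight_gf_image) auto
  finally show ?thesis
    unfolding right_diff_distrib mult_1_right diff_eq_eq mult.commute[of _ "fps_X ^ Suc N"] .
qed

text \<open>The part \<open>Suc N\<close> is used at most once: the sets without it give the summand
  1, those with it the power of \<open>fps_X\<close>.\<close>

lemma weight_gf_Pow_Suc:
  "weight_gf (Pow {1..Suc N}) \<Sum> = weight_gf (Pow {1..N}) \<Sum> * (1 + fps_X ^ Suc N)"
proof -
  have Pow: "Pow {1..Suc N} = Pow {1..N} \<union> insert (Suc N) ` Pow {1..N}"
    by (simp add: atLeastAtMostSuc_conv Pow_insert)
  have "weight_gf (Pow {1..Suc N}) \<Sum> =
      weight_gf (Pow {1..N}) \<Sum> + weight_gf (insert (Suc N) ` Pow {1..N}) \<Sum>"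
    unfolding Pow by (rule weight_gf_Un) auto
  also have "weight_gf (insert (Suc N) ` Pow {1..N}) \<Sum> = fps_X ^ Suc N * weight_gf (Pow {1..N}) \<Sum>"
  proof (rule weight_gf_image)
    show "inj_on (insert (Suc N)) (Pow {1..N})"
      by (rule inj_onI) (auto dest!: insert_ident[THEN iffD1, rotated 2])
    fix M assume "M \<in> Pow {1..N}"
    then have "finite M" "Suc N \<notin> M" using finite_subset by auto
    then show "\<Sum>(insert (Suc N) M) = Suc N + \<Sum>M" by simp
  qed
  finally show ?thesis by (simp add: algebra_simps)
qed

section \<open>Overpartitions with bounded part size\<close>

definition bounded_overpartitions :: "nat \<Rightarrow> (nat \<times> bool) list set" where
  "bounded_overpartitions N =
     {xs. sorted_wrt (\<ge>) (map fst xs) \<and> set (map fst xs) \<subseteq> {1..N} \<and>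
          (\<forall>i<length xs. snd (xs ! i) \<longrightarrow> fst (xs ! i) \<notin> set (map fst (take i xs)))}"

abbreviation overpartition_weight :: "(nat \<times> bool) list \<Rightarrow> nat" where
  "overpartition_weight xs \<equiv> sum_list (map fst xs)"

text \<open>Once \<open>x\<close> is put in front, no later part of the same size is a first
  occurrence, so none of them may be overlined. This replaces the condition on indices by one suited
  to recursion.\<close>

lemma overlined_first_Cons:
  "(\<forall>i<length (x # xs). snd ((x # xs) ! i) \<longrightarrow>
      fst ((x # xs) ! i) \<notin> set (map fst (take i (x # xs)))) \<longleftrightarrow>
   (\<forall>i<length xs. snd (xs ! i) \<longrightarrow> fst (xs ! i) \<notin> set (map fst (take i xs))) \<and>
   (fst x, True) \<notin> set xs"
proof -
  have "(fst x, True) \<notin> set xs \<longleftrightarrow> (\<forall>i<length xs. snd (xs ! i) \<longrightarrow> fst (xs ! i) \<noteq> fst x)"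
    by (auto simp: in_set_conv_nth) (metis prod.collapse)
  then show ?thesis by (auto simp: All_less_Suc2)
qed

lemma Nil_in_bounded_overpartitions: "[] \<in> bounded_overpartitions N"
  by (simp add: bounded_overpartitions_def)

lemma Cons_in_bounded_overpartitions:
  "(a, b) # xs \<in> bounded_overpartitions N \<longleftrightarrow>
     xs \<in> bounded_overpartitions N \<and> 1 \<le> a \<and> a \<le> N \<and> (\<forall>x\<in>set xs. fst x \<le> a) \<and> (a, True) \<notin> set xs"
  unfolding bounded_overpartitions_def mem_Collect_eq overlined_first_Cons by auto

lemma bounded_overpartitions_mono:
  "M \<le> N \<Longrightarrow> bounded_overpartitions M \<subseteq> bounded_overpartitions N"
  by (auto simp: bounded_overpartitions_def)

lemma bounded_overpartitions_leD: "xs \<in> bounded_overpartitions N \<Longrightarrow> x \<in> set xs \<Longrightarrow> fst x \<le> N"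
  by (auto simp: bounded_overpartitions_def)

lemma bounded_overpartitions_lower:
  "\<lbrakk>xs \<in> bounded_overpartitions N; \<forall>x\<in>set xs. fst x \<le> M\<rbrakk> \<Longrightarrow> xs \<in> bounded_overpartitions M"
  by (simp add: bounded_overpartitions_def image_subset_iff)

text \<open>An overlined \<open>Suc N\<close> can only be the head, and removing it leaves a list in
  \<open>U (Suc N)\<close>. Within \<open>U (Suc N)\<close> all copies of \<open>Suc N\<close> are
  plain and can be removed one at a time. The first equation accounts for the numerator of a factor,
  the second for its denominator.\<close>

lemma bounded_overpartitions_Suc:
  defines "U \<equiv> \<lambda>N. {xs \<in> bounded_overpartitions N. (N, True) \<notin> set xs}"
  shows "bounded_overpartitions (Suc N) = U (Suc N) \<union> (#) (Suc N, True) ` U (Suc N)" (is ?th1)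
    and "U (Suc N) = bounded_overpartitions N \<union> (#) (Suc N, False) ` U (Suc N)" (is ?th2)
proof -
  \<comment> \<open>Parts decrease weakly, so the head decides whether \<open>Suc N\<close> occurs.
    If it does, the tail has no overlined \<open>Suc N\<close>, whatever the flag of the
    head.\<close>
  have head: "xs \<in> bounded_overpartitions N \<or> (\<exists>b ys. xs = (Suc N, b) # ys \<and> ys \<in> U (Suc N))"
    if "xs \<in> bounded_overpartitions (Suc N)" for xs
  proof (cases xs)
    case Nil
    then show ?thesis by (simp add: Nil_in_bounded_overpartitions)
  next
    case (Cons x ys)
    obtain a b where x: "x = (a, b)" by (cases x)
    show ?thesis
    proof (cases "a = Suc N")
      case True
      then show ?thesis using that Cons x by (auto simp: U_def Cons_in_bounded_overpartitions)
    next
      case False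
      then have "\<forall>y\<in>set xs. fst y \<le> N"
        using that Cons x by (force simp: Cons_in_bounded_overpartitions)
      then show ?thesis using bounded_overpartitions_lower[OF that] by blast
    qed
  qed
  have Cons: "(Suc N, b) # ys \<in> bounded_overpartitions (Suc N)" if "ys \<in> U (Suc N)" for b ys
    using that by (auto simp: U_def Cons_in_bounded_overpartitions dest: bounded_overpartitions_leD)
  have sub: "bounded_overpartitions N \<subseteq> U (Suc N)"
    using bounded_overpartitions_mono[of N "Suc N"] by (auto simp: U_def dest: bounded_overpartitions_leD)
  show ?th2
  proof (intro set_eqI iffI)
    fix xs assume "xs \<in> U (Suc N)"
    then show "xs \<in> bounded_overpartitions N \<union> (#) (Suc N, False) ` U (Suc N)"
      using head[of xs] by (auto simp: U_def)
  next
    fix xs assume "xs \<in> bounded_overpartitions N \<union> (#) (Suc N, False) ` U (Suc N)"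
    then show "xs \<in> U (Suc N)"
      using sub Cons[where b = False] by (auto simp: U_def)
  qed
  show ?th1
  proof (intro set_eqI iffI)
    fix xs assume "xs \<in> bounded_overpartitions (Suc N)"
    then show "xs \<in> U (Suc N) \<union> (#) (Suc N, True) ` U (Suc N)"
      using head[of xs] sub by (auto simp: U_def)
  next
    fix xs assume "xs \<in> U (Suc N) \<union> (#) (Suc N, True) ` U (Suc N)"
    then show "xs \<in> bounded_overpartitions (Suc N)"
      using Cons[where b = True] by (auto simp: U_def)
  qed
qed

lemma finite_bounded_overpartitions:
  "finite {xs \<in> bounded_overpartitions N. overpartition_weight xs = k}"
proof (rule finite_subset)
  show "{xs \<in> bounded_overpartitions N. overpartition_weight xs = k} \<subseteq>
      {xs. set xs \<subseteq> {1..N} \<times> UNIV \<and> length xs \<le> k}"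
  proof clarify
    fix xs assume "xs \<in> bounded_overpartitions N"
    then have *: "set (map fst xs) \<subseteq> {1..N}" by (simp add: bounded_overpartitions_def)
    then have "length (map fst xs) \<le> overpartition_weight xs"
      by (intro length_le_sum_list) auto
    then show "set xs \<subseteq> {1..N} \<times> UNIV \<and> length xs \<le> overpartition_weight xs"
      using * by (auto simp: image_subset_iff)
  qed
qed (simp add: finite_lists_length_le)

text \<open>Both series are multiples of the series of \<open>U\<close>, by
  \<open>1 + fps_X ^ Suc N\<close> and \<open>1 - fps_X ^ Suc N\<close> respectively;
  cross-multiplying eliminates it.\<close>

lemma weight_gf_bounded_overpartitions_Suc:
  "weight_gf (bounded_overpartitions (Suc N)) overpartition_weight * (1 - fps_X ^ Suc N) =
   weight_gf (bounded_overpartitions N) overpartition_weight * (1 + fps_X ^ Suc N)"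
proof -
  define U where "U = {xs \<in> bounded_overpartitions (Suc N). (Suc N, True) \<notin> set xs}"
  let ?w = overpartition_weight
  note Suc = bounded_overpartitions_Suc[of N, folded U_def]
  have fin: "finite {xs \<in> S. ?w xs = k}" if "S \<subseteq> bounded_overpartitions (Suc N)" for S k
    by (rule finite_subset[OF _ finite_bounded_overpartitions[of "Suc N" k]]) (use that in blast)
  have Cons: "weight_gf ((#) (Suc N, b) ` U) ?w = fps_X ^ Suc N * weight_gf U ?w" for b
    by (rule weight_gf_image) auto
  have sub: "U \<subseteq> bounded_overpartitions (Suc N)" "(#) (Suc N, True) ` U \<subseteq> bounded_overpartitions (Suc N)"
    "bounded_overpartitions N \<subseteq> U" "(#) (Suc N, False) ` U \<subseteq> U"
    using Suc by blast+
  have disj: "U \<inter> (#) (Suc N, True) ` U = {}"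
    "bounded_overpartitions N \<inter> (#) (Suc N, False) ` U = {}"
    by (auto simp: U_def Cons_in_bounded_overpartitions)
  have "weight_gf (bounded_overpartitions (Suc N)) ?w =
      weight_gf U ?w + weight_gf ((#) (Suc N, True) ` U) ?w"
    by (subst Suc(1), rule weight_gf_Un) (intro disj fin sub)+
  then have 1: "weight_gf (bounded_overpartitions (Suc N)) ?w = weight_gf U ?w * (1 + fps_X ^ Suc N)"
    unfolding Cons by (simp add: algebra_simps)
  have "weight_gf U ?w =
      weight_gf (bounded_overpartitions N) ?w + weight_gf ((#) (Suc N, False) ` U) ?w"
    by (subst Suc(2), rule weight_gf_Un) (intro disj fin sub subset_trans[OF _ sub(1)])+
  then have 2: "weight_gf (bounded_overpartitions N) ?w = weight_gf U ?w * (1 - fps_X ^ Suc N)"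
    unfolding Cons right_diff_distrib mult_1_right eq_diff_eq mult.commute[of _ "fps_X ^ Suc N"]
    by (rule sym)
  show ?thesis unfolding 1 2 by (simp only: ac_simps)
qed

section \<open>Comparison of pairs with overpartitions, and the product formula\<close>

lemma one_minus_fps_X_power_neq_0: "1 - fps_X ^ Suc N \<noteq> (0 :: rat fps)"
proof
  assume "1 - fps_X ^ Suc N = (0 :: rat fps)"
  then have "(1 - fps_X ^ Suc N :: rat fps) $ 0 = 0" by (simp only: fps_zero_nth)
  then show False by simp
qed

text \<open>Both sides equal 1 for \<open>N = 0\<close> and satisfy the same recursion after
  multiplication by \<open>1 - fps_X ^ Suc N\<close>; this nonzero factor cancels in rational power
  series.\<close>

lemma weight_gf_partition_pairs:
  "weight_gf (partition_pairs N) pair_weight =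
   weight_gf (bounded_overpartitions N) overpartition_weight"
proof -
  have "weight_gf (partition_pairs N) pair_weight =
      weight_gf (bounded_partitions N) sum_list * weight_gf (Pow {1..N}) \<Sum>"
    unfolding partition_pairs_def pair_weight_def
    by (rule weight_gf_Times) (auto simp: finite_bounded_partitions)
  also have "\<dots> = weight_gf (bounded_overpartitions N) overpartition_weight"
  proof (induction N)
    case 0
    have "bounded_partitions 0 = {[]}" "bounded_overpartitions 0 = {[]}"
      by (auto simp: bounded_partitions_def bounded_overpartitions_def)
    then show ?case by (simp add: weight_gf_singleton)
  next
    case (Suc N)
    let ?P = "\<lambda>N. weight_gf (bounded_partitions N) sum_list"
      and ?Q = "\<lambda>N. weight_gf (Pow {1..N}) \<Sum>"
      and ?O = "\<lambda>N. weight_gf (bounded_overpartitions N) overpartition_weight"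
    have "(?P (Suc N) * ?Q (Suc N)) * (1 - fps_X ^ Suc N) =
        (?P (Suc N) * (1 - fps_X ^ Suc N)) * ?Q (Suc N)"
      by (simp only: ac_simps)
    also have "\<dots> = (?P N * ?Q N) * (1 + fps_X ^ Suc N)"
      unfolding weight_gf_bounded_partitions_Suc weight_gf_Pow_Suc by (simp only: ac_simps)
    also have "\<dots> = ?O (Suc N) * (1 - fps_X ^ Suc N)"
      unfolding Suc.IH weight_gf_bounded_overpartitions_Suc ..
    finally show ?case using one_minus_fps_X_power_neq_0[of N] by simp
  qed
  finally show ?thesis .
qed

text \<open>Iterates the recursion in \<open>N\<close>. Division is legitimate since each
  denominator has constant coefficient 1; index \<open>k\<close> stands for part size
  \<open>Suc k\<close>.\<close>

lemma weight_gf_bounded_overpartitions: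
  "weight_gf (bounded_overpartitions N) overpartition_weight =
   (\<Prod>k<N. (1 + fps_X ^ Suc k) / (1 - fps_X ^ Suc k))"
proof (induction N)
  case 0
  have "bounded_overpartitions 0 = {[]}" by (auto simp: bounded_overpartitions_def)
  then show ?case by (simp add: weight_gf_singleton)
next
  case (Suc N)
  let ?O = "\<lambda>N. weight_gf (bounded_overpartitions N) overpartition_weight"
  let ?d = "1 - fps_X ^ Suc N :: rat fps"
  have unit: "?d $ 0 \<noteq> 0" by simp
  have "?O (Suc N) = ?O (Suc N) * ?d * inverse ?d"
    using inverse_mult_eq_1'[OF unit] by (simp only: mult.assoc mult_1_right)
  also have "\<dots> = ?O N * ((1 + fps_X ^ Suc N) / ?d)"
    unfolding weight_gf_bounded_overpartitions_Suc fps_divide_unit[OF unit] by (simp only: mult.assoc)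
  finally show ?case by (simp only: Suc.IH prod.lessThan_Suc)
qed

section \<open>From bounded part sizes to the limit sequence\<close>

lemma overpartitions_eq_bounded:
  assumes "k \<le> N"
  shows "overpartitions k = {xs \<in> bounded_overpartitions N. overpartition_weight xs = k}"
proof -
  \<comment> \<open>No part exceeds the total \<open>k\<close>, hence none exceeds
    \<open>N\<close>.\<close>
  have "set (map fst xs) \<subseteq> {1..N} \<longleftrightarrow> (\<forall>a\<in>set (map fst xs). a \<ge> 1)"
    if "overpartition_weight xs = k" for xs
    using member_le_sum_list[of _ "map fst xs"] that assms by fastforce
  then show ?thesis
    unfolding overpartitions_def bounded_overpartitions_def by blast
qed

lemma weight_gf_bounded_overpartitions_nth:
  "k \<le> N \<Longrightarrow> weight_gf (bounded_overpartitions N) overpartition_weight $ k =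
     of_nat (card (overpartitions k))"
  by (simp add: weight_gf_nth overpartitions_eq_bounded)

lemma av_1324_1342:
  assumes "k + 2 \<le> n"
  shows "av {[1,3,2,4], [1,3,4,2]} n k = card (overpartitions k)"
proof -
  \<comment> \<open>The bound on part sizes is taken to be \<open>k\<close>, which meets the
    requirement \<open>k \<le> N\<close> on both sides.\<close>
  have "of_nat (av {[1,3,2,4], [1,3,4,2]} n k) = weight_gf (partition_pairs k) pair_weight $ k"
    unfolding weight_gf_nth av_1324_1342_eq_card_pairs[OF assms order_refl] ..
  also have "\<dots> = of_nat (card (overpartitions k))"
    by (simp add: weight_gf_partition_pairs weight_gf_bounded_overpartitions_nth)
  finally show ?thesis by (simp only: of_nat_eq_iff)
qed

lemma limit_sequence_eqI:
  assumes "has_limit_sequence B c"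
  shows "limit_sequence B = c"
  unfolding limit_sequence_def
proof (rule the_equality)
  fix d assume d: "has_limit_sequence B d"
  show "d = c"
  proof
    fix k
    obtain m where "\<forall>n\<ge>m. av B n k = c k" using assms by (auto simp: has_limit_sequence_def)
    moreover obtain m' where "\<forall>n\<ge>m'. av B n k = d k" using d by (auto simp: has_limit_sequence_def)
    \<comment> \<open>Both values equal \<open>av B n k\<close> at
      \<open>n = max m m'\<close>.\<close>
    ultimately show "d k = c k" by (metis max.cobounded1 max.cobounded2)
  qed
qed fact

theorem proposition5p7:
  shows "(\<forall>k n. n \<ge> k + 2 \<longrightarrow>
            av {[1,3,2,4], [1,3,4,2]} n k = card (overpartitions k)) \<and>
         has_limit_sequence {[1,3,2,4], [1,3,4,2]} (limit_sequence {[1,3,2,4], [1,3,4,2]}) \<and>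
         (\<lambda>k. (1 + fps_X ^ Suc k) / (1 - fps_X ^ Suc k)) has_prod
           limit_gf {[1,3,2,4], [1,3,4,2]}"
proof (intro conjI allI impI)
  let ?B = "{[1,3,2,4], [1,3,4,2]} :: nat list set"
  fix k n :: nat assume "k + 2 \<le> n"
  then show "av ?B n k = card (overpartitions k)" by (rule av_1324_1342)
next
  let ?B = "{[1,3,2,4], [1,3,4,2]} :: nat list set"
  let ?f = "\<lambda>k. (1 + fps_X ^ Suc k) / (1 - fps_X ^ Suc k) :: rat fps"
  let ?O = "\<lambda>N. weight_gf (bounded_overpartitions N) overpartition_weight"
  have lim: "has_limit_sequence ?B (\<lambda>k. card (overpartitions k))"
    unfolding has_limit_sequence_def using av_1324_1342 by blast
  then show "has_limit_sequence ?B (limit_sequence ?B)"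
    unfolding limit_sequence_eqI[OF lim] .
  define L where "L = limit_gf ?B"
  have gf: "L $ k = of_nat (card (overpartitions k))" for k
    unfolding L_def limit_gf_def limit_sequence_eqI[OF lim] by simp
  \<comment> \<open>Convergence of power series is eventual constancy of each coefficient, and
    coefficient \<open>k\<close> is final once parts up to \<open>k\<close> are allowed.
    \<open>Suc n\<close> appears because the partial products of \<open>raw_has_prod\<close> include
    index \<open>n\<close>.\<close>
  have "(\<lambda>n. ?O (Suc n)) \<longlonglongrightarrow> L"
  proof (rule tendsto_fpsI)
    fix k
    show "eventually (\<lambda>n. ?O (Suc n) $ k = L $ k) sequentially"
      using eventually_ge_at_top[of k] by eventually_elim (simp add: weight_gf_bounded_overpartitions_nth gf)
  qed
  \<comment> \<open>\<open>raw_has_prod\<close> demands a nonzero limit. The constant coefficient is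
    that of the empty product, namely 1.\<close>
  moreover have "L $ 0 = ?O 0 $ 0" by (simp add: gf weight_gf_bounded_overpartitions_nth)
  then have "L \<noteq> 0"
    by (auto simp: weight_gf_bounded_overpartitions)
  ultimately have "raw_has_prod ?f 0 (L)"
    by (simp add: raw_has_prod_def weight_gf_bounded_overpartitions lessThan_Suc_atMost)
  then show "?f has_prod limit_gf ?B"
    unfolding L_def[symmetric] by (simp add: has_prod_def)
qed

end
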